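(* Let $d\ge 1$, $1\le m\le d$, $y\in\{+1,-1\}$, let $e_1,\dots,e_d$ be the principal components (an orthonormal basis of $\mathbb{R}^d$), let $z=\sum_{i=1}^d\alpha_i e_i\in\mathbb{R}^d$ be a representation with label $y$, let $\Delta q=\sum_{i=1}^d\gamma_i e_i$ be the learned decision boundary vector, and let $\Delta p=\sum_{i=1}^d\eta_i\gamma_i e_i$ be the causal decision boundary vector, which satisfies $y\,(z\cdot\Delta p)>0$. Let $\hat z$ and $\Delta\hat q$ be the trimmed representation and the trimmed decision boundary vector. Suppose $z$ is correctly classified by $\Delta q$, i.e. $y\,(z\cdot\Delta q)>0$. If either of the following holds: 1. $y\,\big((z-\hat z)\cdot\Delta q\big)\le 0$; or 2. $y\,\big((z-\hat z)\cdot\Delta q\big)>0$, the Causal Preservation condition holds for $\hat z$, i.e. at least one of $$y\sum_{i=1}^m\eta_i\alpha_i\gamma_i=0,\qquad y\sum_{i=1}^m\eta_i\alpha_i\gamma_i<0,\qquad 0<y\sum_{i=1}^m\eta_i\alpha_i\gamma_i<y\sum_{i=1}^d\eta_i\alpha_i\gamma_i$$ holds, and $$\mathrm{sign}\left(\sum_{i=m+1}^d\eta_i\alpha_i\gamma_i\right)=\mathrm{sign}\left(\sum_{i=m+1}^d\alpha_i\gamma_i\right);$$ then the trimmed representation is still classified correctly, i.e. $y\,(\hat z\cdot\Delta\hat q)>0$.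
   Context: Setting: binary classification with labels in $\{+1,-1\}$ and representations in $\mathbb{R}^d$, with no bias term. The classifier has learned prototypes $q_{+1},q_{-1}\in\mathbb{R}^d$, with learned decision boundary vector $\Delta q=q_{+1}-q_{-1}$. It is assumed that there exist causal prototypes $p_{+1},p_{-1}\in\mathbb{R}^d$ that always make correct predictions on the learned representations; the causal decision boundary vector is $\Delta p=p_{+1}-p_{-1}$. A representation $z$ with label $y$ is classified correctly by a decision boundary vector $v$ if $y\,(z\cdot v)>0$. Here $\mathrm{sign}(t)\in\{-1,0,1\}$ is the usual sign. Principal components: given $z$ and representations $\tilde z_1,\dots,\tilde z_n\in\mathbb{R}^d$ of augmented variants of the same sample, let $\mathbf{Z}$ be the matrix with rows $z,\tilde z_1,\dots,\tilde z_n$ and $\bar{\mathbf{Z}}$ the matrix of the same size all of whose rows are the mean of these $n+1$ vectors. Then $e_1,\dots,e_d$ are orthonormal eigenvectors of $(\mathbf{Z}-\bar{\mathbf{Z}})^\top(\mathbf{Z}-\bar{\mathbf{Z}})$, ordered by non-increasing eigenvalue; they form an orthonormal basis of $\mathbb{R}^d$. Write $\alpha_i=z\cdot e_i$, $\gamma_i=\Delta q\cdot e_i$; the coordinates of $\Delta p$ are written $\Delta p\cdot e_i=\eta_i\gamma_i$ with real numbers $\eta_i$. Trimming (removing the top-$m$ principal components): $\hat z=z-\sum_{i=1}^m(z\cdot e_i)e_i$, $\hat q_{\pm1}=q_{\pm1}-\sum_{i=1}^m(q_{\pm1}\cdot e_i)e_i$, and $\Delta\hat q=\hat q_{+1}-\hat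 q_{-1}$. The updated prediction is correct iff $y\,(\hat z\cdot\Delta\hat q)>0$. *)

theory Defs
  imports "HOL-Analysis.Analysis"
begin

definition mean_matrix :: "real ^ 'd ^ 'k \<Rightarrow> real ^ 'd ^ 'k" where
  "mean_matrix Z = (\<chi> k. (1 / real CARD('k)) *\<^sub>R (\<Sum>l\<in>UNIV. row l Z))"

definition scatter_matrix :: "real ^ 'd ^ 'k \<Rightarrow> real ^ 'd ^ 'd" where
  "scatter_matrix Z = transpose (Z - mean_matrix Z) ** (Z - mean_matrix Z)"

text \<open>
  The components are ordered, hence indexed by the numbers from 1 to the dimension
  rather than by the coordinate type; values of \<open>e\<close> outside this range are irrelevant.
  Eigenvectors are nonzero because they are normalised, and
  orthonormal vectors in this number form a basis.
\<close>

definition principal_components :: "real ^ 'd ^ 'k \<Rightarrow> (nat \<Rightarrow> real ^ 'd) \<Rightarrow> bool" where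
  "principal_components Z e \<longleftrightarrow>
     (\<forall>i\<in>{1..CARD('d)}. \<forall>j\<in>{1..CARD('d)}. e i \<bullet> e j = (if i = j then 1 else 0)) \<and>
     (\<exists>ev :: nat \<Rightarrow> real.
        (\<forall>i\<in>{1..CARD('d)}. scatter_matrix Z *v e i = ev i *\<^sub>R e i) \<and>
        (\<forall>i\<in>{1..CARD('d)}. \<forall>j\<in>{1..CARD('d)}. i \<le> j \<longrightarrow> ev j \<le> ev i))"

definition trim :: "nat \<Rightarrow> (nat \<Rightarrow> real ^ 'd) \<Rightarrow> real ^ 'd \<Rightarrow> real ^ 'd" where
  "trim m e x = x - (\<Sum>i=1..m. (x \<bullet> e i) *\<^sub>R e i)"

definition correctly_classified :: "real ^ 'd \<Rightarrow> real ^ 'd \<Rightarrow> real \<Rightarrow> bool" where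
  "correctly_classified v z y \<longleftrightarrow> y * (z \<bullet> v) > 0"

definition causal_preservation ::
    "nat \<Rightarrow> nat \<Rightarrow> real \<Rightarrow> (nat \<Rightarrow> real) \<Rightarrow> (nat \<Rightarrow> real) \<Rightarrow> (nat \<Rightarrow> real) \<Rightarrow> bool" where
  "causal_preservation d m y \<eta> \<alpha> \<gamma> \<longleftrightarrow>
     y * (\<Sum>i=1..m. \<eta> i * \<alpha> i * \<gamma> i) = 0 \<or>
     y * (\<Sum>i=1..m. \<eta> i * \<alpha> i * \<gamma> i) < 0 \<or>
     (0 < y * (\<Sum>i=1..m. \<eta> i * \<alpha> i * \<gamma> i) \<and>
      y * (\<Sum>i=1..m. \<eta> i * \<alpha> i * \<gamma> i) < y * (\<Sum>i=1..d. \<eta> i * \<alpha> i * \<gamma> i))"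

end

theory Submission
  imports Defs
begin

text \<open>
  In the basis \<open>e\<close> all the quantities involved are partial sums of coordinate products: trimming
  keeps the coordinates above \<open>m\<close>, so the updated score is the full score \<open>z \<bullet> \<Delta>q\<close> minus the
  score of the removed part \<open>z - trim m e z\<close>. If the removed part contributes nothing positive,
  the updated score stays positive. Otherwise each alternative of causal preservation says that
  the causal score of the removed part is smaller than the full causal score, which is positive;
  so the causal tail sum has the sign of \<open>y\<close>, and hence so does the updated score.
\<close>

text \<open>Each \<open>e i\<close> with \<open>i\<close> in \<open>A\<close> meets only its own
  term of the second sum. Letting \<open>A\<close> be smaller than \<open>B\<close> also covers a
  single vector or a tail against a full expansion.\<close>

lemma inner_orthonormal_sums:
  fixes e :: "'i \<Rightarrow> 'a::real_inner"
  assumes orth: "\<And>i j. i \<in> B \<Longrightarrow> j \<in> B \<Longrightarrow> e i \<bullet> e j = (if i = j then 1 else 0)"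
    and "finite B" "A \<subseteq> B"
  shows "(\<Sum>i\<in>A. a i *\<^sub>R e i) \<bullet> (\<Sum>j\<in>B. b j *\<^sub>R e j) = (\<Sum>i\<in>A. a i * b i)"
proof -
  have "e i \<bullet> (\<Sum>j\<in>B. b j *\<^sub>R e j) = b i" if "i \<in> A" for i
  proof -
    have "i \<in> B" using that assms(3) by blast
    have "e i \<bullet> (\<Sum>j\<in>B. b j *\<^sub>R e j) = (\<Sum>j\<in>B. if j = i then b j else 0)"
      unfolding inner_sum_right by (rule sum.cong) (auto simp: orth \<open>i \<in> B\<close>)
    then show ?thesis using \<open>i \<in> B\<close> \<open>finite B\<close> by simp
  qed
  then show ?thesis by (simp add: inner_sum_left)
qed

text \<open>Only the difference of the prototypes has given coordinates, so linearity is needed to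
  compute with the trimmed prototypes.\<close>

lemma trim_diff: "trim m e (x - x') = trim m e x - trim m e x'"
  by (simp add: trim_def inner_diff_left scaleR_left_diff_distrib sum_subtractf)

lemma sum_split_at:
  fixes f :: "nat \<Rightarrow> 'a::comm_monoid_add"
  assumes "m \<le> d"
  shows "(\<Sum>i=1..d. f i) = (\<Sum>i=1..m. f i) + (\<Sum>i=m+1..d. f i)"
  using sum.ub_add_nat[of 1 m f "d - m"] assms by simp

lemma trim_orthonormal_sum:
  assumes orth: "\<And>i j. i \<in> {1..d} \<Longrightarrow> j \<in> {1..d} \<Longrightarrow> e i \<bullet> e j = (if i = j then 1 else 0)"
    and "m \<le> d"
  shows "trim m e (\<Sum>i=1..d. c i *\<^sub>R e i) = (\<Sum>i=m+1..d. c i *\<^sub>R e i)"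
proof -
  \<comment> \<open>The vector \<open>e j\<close> is the sum over the singleton \<open>{j}\<close>
    with coefficient 1.\<close>
  have "(\<Sum>i=1..d. c i *\<^sub>R e i) \<bullet> e j = c j" if "j \<in> {1..m}" for j
    using inner_orthonormal_sums[OF orth, of "{1..d}" "{j}" "\<lambda>_. 1" c] that \<open>m \<le> d\<close>
    by (simp add: inner_commute)
  then have "(\<Sum>j=1..m. ((\<Sum>i=1..d. c i *\<^sub>R e i) \<bullet> e j) *\<^sub>R e j) = (\<Sum>j=1..m. c j *\<^sub>R e j)"
    by (intro sum.cong) auto
  then show ?thesis
    unfolding trim_def using sum_split_at[OF \<open>m \<le> d\<close>, of "\<lambda>i. c i *\<^sub>R e i"] by simp
qed

theorem proposition3:
  fixes Z :: "real ^ 'd ^ 'k" and k0 :: 'k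
    and z q_pos q_neg p_pos p_neg \<Delta>q \<Delta>p :: "real ^ 'd"
    and e :: "nat \<Rightarrow> real ^ 'd"
    and \<alpha> \<gamma> \<eta> :: "nat \<Rightarrow> real"
    and y :: real and m :: nat
  assumes m: "1 \<le> m" "m \<le> CARD('d)"
    and y: "y \<in> {1, -1}"
    and z_row: "row k0 Z = z"
    and pc: "principal_components Z e"
    and \<Delta>q: "\<Delta>q = q_pos - q_neg"
    and \<Delta>p: "\<Delta>p = p_pos - p_neg"
    and z_coords: "z = (\<Sum>i=1..CARD('d). \<alpha> i *\<^sub>R e i)"
    and \<Delta>q_coords: "\<Delta>q = (\<Sum>i=1..CARD('d). \<gamma> i *\<^sub>R e i)"
    and \<Delta>p_coords: "\<Delta>p = (\<Sum>i=1..CARD('d). (\<eta> i * \<gamma> i) *\<^sub>R e i)"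
    and causal: "correctly_classified \<Delta>p z y"
    and learned: "correctly_classified \<Delta>q z y"
    and cond:
      "y * ((z - trim m e z) \<bullet> \<Delta>q) \<le> 0 \<or>
       (y * ((z - trim m e z) \<bullet> \<Delta>q) > 0 \<and>
        causal_preservation CARD('d) m y \<eta> \<alpha> \<gamma> \<and>
        sgn (\<Sum>i=m+1..CARD('d). \<eta> i * \<alpha> i * \<gamma> i) = sgn (\<Sum>i=m+1..CARD('d). \<alpha> i * \<gamma> i))"
  shows "correctly_classified (trim m e q_pos - trim m e q_neg) (trim m e z) y"
proof -
  let ?d = "CARD('d)"
  have orth: "e i \<bullet> e j = (if i = j then 1 else 0)" if "i \<in> {1..?d}" "j \<in> {1..?d}" for i j
    using pc that unfolding principal_components_def by blast
  have trim_z: "trim m e z = (\<Sum>i=m+1..?d. \<alpha> i *\<^sub>R e i)"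
    unfolding z_coords by (rule trim_orthonormal_sum[OF orth m(2)])
  have trim_q: "trim m e q_pos - trim m e q_neg = (\<Sum>i=m+1..?d. \<gamma> i *\<^sub>R e i)"
    unfolding trim_diff[symmetric] \<Delta>q[symmetric] \<Delta>q_coords
    by (rule trim_orthonormal_sum[OF orth m(2)])
  have score: "z \<bullet> \<Delta>q = (\<Sum>i=1..?d. \<alpha> i * \<gamma> i)"
    unfolding z_coords \<Delta>q_coords by (rule inner_orthonormal_sums[OF orth]) auto
  have causal_score: "z \<bullet> \<Delta>p = (\<Sum>i=1..?d. \<eta> i * \<alpha> i * \<gamma> i)"
    unfolding z_coords \<Delta>p_coords
    by (subst inner_orthonormal_sums[OF orth]) (auto simp: ac_simps)
  have tail: "trim m e z \<bullet> (trim m e q_pos - trim m e q_neg) = (\<Sum>i=m+1..?d. \<alpha> i * \<gamma> i)"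
    unfolding trim_z trim_q by (rule inner_orthonormal_sums[OF orth]) auto
  \<comment> \<open>The trimmed \<open>z\<close> is orthogonal to the removed components, so its
    product with the untrimmed boundary is the same tail sum. This ties \<open>cond\<close>, stated
    with \<open>\<Delta>q\<close>, to the goal.\<close>
  have tail': "trim m e z \<bullet> \<Delta>q = (\<Sum>i=m+1..?d. \<alpha> i * \<gamma> i)"
    unfolding trim_z \<Delta>q_coords by (rule inner_orthonormal_sums[OF orth]) auto
  have "0 < y * (\<Sum>i=m+1..?d. \<alpha> i * \<gamma> i)"
    using cond
  proof
    assume "y * ((z - trim m e z) \<bullet> \<Delta>q) \<le> 0"
    then show ?thesis
      using learned unfolding correctly_classified_def inner_diff_left tail' right_diff_distrib
      by linarith
  next
    assume c: "y * ((z - trim m e z) \<bullet> \<Delta>q) > 0 \<and>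
      causal_preservation ?d m y \<eta> \<alpha> \<gamma> \<and>
      sgn (\<Sum>i=m+1..?d. \<eta> i * \<alpha> i * \<gamma> i) = sgn (\<Sum>i=m+1..?d. \<alpha> i * \<gamma> i)"
    have total: "0 < y * (\<Sum>i=1..?d. \<eta> i * \<alpha> i * \<gamma> i)"
      using causal unfolding correctly_classified_def causal_score .
    \<comment> \<open>The first two alternatives need \<open>total\<close>; the third is the claim
      itself.\<close>
    then have "y * (\<Sum>i=1..m. \<eta> i * \<alpha> i * \<gamma> i) < y * (\<Sum>i=1..?d. \<eta> i * \<alpha> i * \<gamma> i)"
      using c unfolding causal_preservation_def by linarith
    then have "0 < y * (\<Sum>i=m+1..?d. \<eta> i * \<alpha> i * \<gamma> i)"
      unfolding sum_split_at[OF m(2)] distrib_left by linarith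
    \<comment> \<open>The sign hypothesis does not mention \<open>y\<close>; multiplicativity of
      \<open>sgn\<close> splits it off so that the two tail signs can be exchanged.\<close>
    then have "0 < sgn y * sgn (\<Sum>i=m+1..?d. \<eta> i * \<alpha> i * \<gamma> i)"
      unfolding sgn_mult[symmetric] by (rule sgn_greater[THEN iffD2])
    then have "0 < sgn y * sgn (\<Sum>i=m+1..?d. \<alpha> i * \<gamma> i)"
      using c by (elim conjE) (erule subst)
    then show ?thesis
      unfolding sgn_mult[symmetric] by (rule sgn_greater[THEN iffD1])
  qed
  then show ?thesis
    unfolding correctly_classified_def tail .
qed

end
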